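(* Let $A$ be an $m\times m$ nonsingular real matrix and let $z\in\mathbb{R}^m$. For any starting point $x_0\in\mathbb{R}^m$, the semi-smooth Newton sequence $\{x_k\}$, determined by $$\left(\left(A^\top A-I\right)\operatorname{diag}(\operatorname{sgn}(x_k^+))+I\right)x_{k+1}=A^\top z,\qquad k=0,1,2,\ldots,$$ is bounded. Moreover, for each accumulation point $\bar x$ of $\{x_k\}$ there exists $\hat x\in\mathbb{R}^m$ such that $$\left(\left(A^\top A-I\right)\operatorname{diag}(\operatorname{sgn}(\hat x^+))+I\right)\bar x=A^\top z.$$
   Context: $I$ is the $m\times m$ identity matrix. For $x=(x^1,\dots,x^m)\in\mathbb{R}^m$, $x^+=(\max\{x^1,0\},\dots,\max\{x^m,0\})$; $\operatorname{sgn}(x)$ is the vector whose components are $1$, $0$ or $-1$ according to whether the corresponding component of $x$ is positive, zero or negative; $\operatorname{diag}(x)$ is the diagonal matrix with diagonal entries the components of $x$. So $\operatorname{diag}(\operatorname{sgn}(x^+))$ is diagonal with entries $1$ where $x^i>0$ and $0$ elsewhere. An accumulation point of a sequence is the limit of some subsequence. *)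

theory Defs
  imports "HOL-Analysis.Analysis"
begin

definition pos_part_vec :: "real ^ 'm \<Rightarrow> real ^ 'm" where
  "pos_part_vec x = (\<chi> i. max (x $ i) 0)"

(* The library's sgn on real ^ 'm is normalisation by the Euclidean norm, hence a
   separate componentwise sign. *)
definition sgn_vec :: "real ^ 'm \<Rightarrow> real ^ 'm" where
  "sgn_vec x = (\<chi> i. sgn (x $ i))"

definition diag_mat :: "real ^ 'm \<Rightarrow> real ^ 'm ^ 'm" where
  "diag_mat x = (\<chi> i j. if i = j then x $ i else 0)"

definition newton_matrix :: "real ^ 'm ^ 'm \<Rightarrow> real ^ 'm \<Rightarrow> real ^ 'm ^ 'm" where
  "newton_matrix A x =
     (transpose A ** A - mat 1) ** diag_mat (sgn_vec (pos_part_vec x)) + mat 1"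

definition newton_sequence ::
  "real ^ 'm ^ 'm \<Rightarrow> real ^ 'm \<Rightarrow> real ^ 'm \<Rightarrow> (nat \<Rightarrow> real ^ 'm) \<Rightarrow> bool" where
  "newton_sequence A z x0 x \<longleftrightarrow>
     x 0 = x0 \<and> (\<forall>k. newton_matrix A (x k) *v x (Suc k) = transpose A *v z)"

definition accumulation_point :: "(nat \<Rightarrow> 'a::topological_space) \<Rightarrow> 'a \<Rightarrow> bool" where
  "accumulation_point x l \<longleftrightarrow> (\<exists>r. strict_mono r \<and> (x \<circ> r) \<longlonglongrightarrow> l)"

end

theory Submission
  imports Defs
begin

text \<open>
  Write \<open>D\<close> for the diagonal 0-1 matrix in the Newton matrix and \<open>w = D v\<close>. Testing
  \<open>((A\<^sup>T A - I) D + I) v = 0\<close> against \<open>w\<close> gives \<open>|A w|\<^sup>2 + w \<bullet> (v - w) = 0\<close>, where the second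
  summand vanishes because \<open>D\<close> is a projection. So \<open>w = 0\<close> and then \<open>v = 0\<close>: the Newton matrix
  is invertible. As there are only finitely many \<open>D\<close>, the iterates \<open>x\<^sub>1, x\<^sub>2, \<dots>\<close> lie in a finite
  set, hence are bounded, and every accumulation point is itself an iterate.
\<close>

lemma sgn_vec_pos_part_vec_nth: "sgn_vec (pos_part_vec x) $ i = (if x $ i > 0 then 1 else 0)"
  by (simp add: sgn_vec_def pos_part_vec_def max_def)

lemma diag_mat_mult_vec_nth: "(diag_mat d *v v) $ i = d $ i * v $ i"
  by (simp add: diag_mat_def matrix_vector_mult_def if_distrib [where f = "\<lambda>a. a * _"] cong: if_cong)

lemma invertible_newton_matrix:
  fixes A :: "real ^ 'm ^ 'm"
  assumes "invertible A"
  shows "invertible (newton_matrix A x)"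
proof -
  have "v = 0" if v: "newton_matrix A x *v v = 0" for v
  proof -
    define w where "w = diag_mat (sgn_vec (pos_part_vec x)) *v v"
    have w_nth: "w $ i = (if x $ i > 0 then v $ i else 0)" for i
      by (simp add: w_def diag_mat_mult_vec_nth sgn_vec_pos_part_vec_nth)
    \<comment> \<open>Regrouping isolates \<open>v - w\<close>, which is supported on the
      coordinates where \<open>w\<close> vanishes.\<close>
    have eq: "transpose A *v (A *v w) + (v - w) = 0"
      using v by (simp add: newton_matrix_def w_def matrix_vector_mult_add_rdistrib
          matrix_vector_mult_diff_rdistrib matrix_vector_mul_assoc [symmetric] algebra_simps)
    have "w \<bullet> (v - w) = 0"
      by (auto simp: inner_vec_def w_nth intro!: sum.neutral)
    moreover have "w \<bullet> (transpose A *v (A *v w)) = (A *v w) \<bullet> (A *v w)"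
      by (simp add: dot_lmul_matrix [symmetric] inner_commute)
    moreover have "w \<bullet> (transpose A *v (A *v w)) + w \<bullet> (v - w) = 0"
      using eq by (metis inner_add_right inner_zero_right)
    ultimately have "A *v w = 0"
      by simp
    with assms have "w = 0"
      by (metis invertible_def matrix_left_invertible_ker)
    with eq show "v = 0"
      by simp
  qed
  \<comment> \<open>For a square matrix a trivial kernel gives a left inverse, which is
    automatically two-sided.\<close>
  then show ?thesis
    by (metis invertible_left_inverse matrix_left_invertible_ker)
qed

text \<open>The matrix depends on \<open>x\<close> only through the set \<open>P\<close> of its
  positive coordinates, and a finite index type has finitely many subsets.\<close>

lemma finite_range_newton_matrix: "finite (range (newton_matrix (A :: real ^ 'm ^ 'm)))"
proof -
  define M where
    "M P = (transpose A ** A - mat 1) ** diag_mat (\<chi> i. if i \<in> P then 1 else 0) + mat 1" for P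
  have "sgn_vec (pos_part_vec x) = (\<chi> i. if i \<in> {i. x $ i > 0} then 1 else 0)" for x :: "real ^ 'm"
    by (simp add: vec_eq_iff sgn_vec_pos_part_vec_nth)
  then have "newton_matrix A x = M {i. x $ i > 0}" for x
    unfolding newton_matrix_def M_def by simp
  then have "range (newton_matrix A) \<subseteq> range M"
    by auto
  then show ?thesis
    by (rule finite_subset) simp
qed

definition newton_step :: "real ^ 'm ^ 'm \<Rightarrow> real ^ 'm \<Rightarrow> real ^ 'm \<Rightarrow> real ^ 'm" where
  "newton_step A z x = matrix_inv (newton_matrix A x) *v (transpose A *v z)"

lemma newton_step_iff:
  assumes "invertible A"
  shows "newton_matrix A x *v y = transpose A *v z \<longleftrightarrow> y = newton_step A z x"
proof -
  \<comment> \<open>\<open>matrix_inv\<close> chooses some two-sided inverse. Each direction of the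
    equivalence uses one of the two equations.\<close>
  have "newton_matrix A x ** matrix_inv (newton_matrix A x) = mat 1 \<and>
    matrix_inv (newton_matrix A x) ** newton_matrix A x = mat 1"
    using invertible_newton_matrix [OF assms, of x]
    unfolding invertible_def matrix_inv_def by (rule someI_ex)
  then show ?thesis
    by (metis newton_step_def matrix_vector_mul_assoc matrix_vector_mul_lid)
qed

lemma finite_range_newton_step: "finite (range (newton_step A z))"
proof (rule finite_surj [OF finite_range_newton_matrix])
  show "range (newton_step A z) \<subseteq>
    (\<lambda>M. matrix_inv M *v (transpose A *v z)) ` range (newton_matrix A)"
    by (auto simp: newton_step_def)
qed

text \<open>Invertibility makes the implicit scheme an explicit recursion, so existence and
  uniqueness of the sequence come together.\<close>

lemma newton_sequence_iff:
  assumes "invertible A"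
  shows "newton_sequence A z x0 x \<longleftrightarrow> x = (\<lambda>k. (newton_step A z ^^ k) x0)"
proof
  assume "newton_sequence A z x0 x"
  then have "x 0 = x0" "\<And>k. x (Suc k) = newton_step A z (x k)"
    by (simp_all add: newton_sequence_def newton_step_iff [OF assms] del: transpose_matrix_vector)
  then have "x k = (newton_step A z ^^ k) x0" for k
    by (induction k) simp_all
  then show "x = (\<lambda>k. (newton_step A z ^^ k) x0)"
    by blast
qed (simp add: newton_sequence_def newton_step_iff [OF assms] del: transpose_matrix_vector)

text \<open>Finite sets are closed in a T1 space. Only the tail has to lie in \<open>S\<close>,
  because an arbitrary starting point need not be a value of the Newton step.\<close>

lemma accumulation_point_of_finite_tail:
  fixes x :: "nat \<Rightarrow> 'a::t1_space"
  assumes "accumulation_point x l" and "finite S" and tail: "\<And>k. x (Suc k) \<in> S"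
  shows "l \<in> S"
proof -
  obtain r where r: "strict_mono r" "(x \<circ> r) \<longlonglongrightarrow> l"
    using assms(1) by (auto simp: accumulation_point_def)
  \<comment> \<open>Since \<open>r n \<ge> n \<ge> 1\<close>, the index \<open>r n\<close> is a
    successor.\<close>
  have "(x \<circ> r) n \<in> S" if "n \<ge> 1" for n
    using seq_suble [OF r(1), of n] that tail [of "r n - 1"] by simp
  then have "eventually (\<lambda>n. (x \<circ> r) n \<in> S) sequentially"
    by (auto simp: eventually_sequentially)
  then show ?thesis
    using Lim_in_closed_set [OF finite_imp_closed [OF \<open>finite S\<close>]] r(2) sequentially_bot by blast
qed

theorem proposition2:
  fixes A :: "real ^ 'm ^ 'm" and z x0 :: "real ^ 'm"
  assumes "invertible A"
  shows "(\<exists>!x. newton_sequence A z x0 x) \<and>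
    (\<forall>x. newton_sequence A z x0 x \<longrightarrow>
      bounded (range x) \<and>
      (\<forall>xbar. accumulation_point x xbar \<longrightarrow>
        (\<exists>xhat. newton_matrix A xhat *v xbar = transpose A *v z)))"
proof (intro conjI allI impI)
  show "\<exists>!x. newton_sequence A z x0 x"
    by (simp add: newton_sequence_iff [OF assms])
next
  fix x
  assume "newton_sequence A z x0 x"
  then have x: "x = (\<lambda>k. (newton_step A z ^^ k) x0)"
    by (simp add: newton_sequence_iff [OF assms])
  have tail: "x (Suc k) \<in> range (newton_step A z)" for k
    by (simp add: x)
  have "range x \<subseteq> insert (x 0) (range (newton_step A z))"
    using tail by (metis image_subsetI insertCI not0_implies_Suc)
  then show "bounded (range x)"
    using finite_range_newton_step [of A z] by (meson finite_imp_bounded finite_insert finite_subset)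
  fix xbar
  assume "accumulation_point x xbar"
  then have "xbar \<in> range (newton_step A z)"
    using finite_range_newton_step tail by (rule accumulation_point_of_finite_tail)
  \<comment> \<open>Any preimage of \<open>xbar\<close> under the Newton step serves as
    \<open>xhat\<close>.\<close>
  then show "\<exists>xhat. newton_matrix A xhat *v xbar = transpose A *v z"
    by (auto simp: newton_step_iff [OF assms] simp del: transpose_matrix_vector)
qed

end
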